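(* Let $ABCD$ be an arbitrary quadrilateral in the Euclidean plane whose diagonals $AC$ and $BD$ meet at $P$. Let the perpendicular bisectors of the segments $AC$ and $BD$ meet at $X$, let the perpendicular bisectors of the segments $AB$ and $CD$ meet at $Y$, and let the perpendicular bisectors of the segments $AD$ and $BC$ meet at $Z$. Let $W$ be the point such that $XYWZ$ is a parallelogram. Suppose that the line through $P$ perpendicular to the line $PW$ meets the side lines $AD$ and $BC$ at $Q$ and $R$, respectively. Then $P$ is the midpoint of $QR$.
   Context: A quadrilateral $ABCD$ is given by four points of the Euclidean plane, no three of which are collinear; it need not be convex, and its diagonals $AC$ and $BD$ are regarded as lines. The parallelogram $XYWZ$ (vertices in this order) may be degenerate: $W$ is the point with $\overrightarrow{XW}=\overrightarrow{XY}+\overrightarrow{XZ}$. The objects named in the statement are assumed to exist: the lines $AC$ and $BD$ intersect in a point; each of the three pairs of perpendicular bisectors (of $AC,BD$; of $AB,CD$; of $AD,BC$) consists of two non-parallel lines, so that $X$, $Y$, $Z$ are well-defined points; $W\neq P$; and the perpendicular to $PW$ at $P$ intersects each of the lines $AD$ and $BC$ in a point. *)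

theory Defs
  imports "HOL-Analysis.Analysis"
begin

definition line_through :: "real^2 \<Rightarrow> real^2 \<Rightarrow> (real^2) set" where
  "line_through A B = affine hull {A, B}"

text \<open>The perpendicular at \<open>P\<close> to the line \<open>UV\<close>; it is a line only if \<open>U \<noteq> V\<close>.\<close>

definition perpendicular_at :: "real^2 \<Rightarrow> real^2 \<Rightarrow> real^2 \<Rightarrow> (real^2) set" where
  "perpendicular_at P U V = {T. orthogonal (T - P) (V - U)}"

definition perp_bisector :: "real^2 \<Rightarrow> real^2 \<Rightarrow> (real^2) set" where
  "perp_bisector A B = perpendicular_at (midpoint A B) A B"

definition quadrilateral :: "real^2 \<Rightarrow> real^2 \<Rightarrow> real^2 \<Rightarrow> real^2 \<Rightarrow> bool" where
  "quadrilateral A B C D \<longleftrightarrow>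
     \<not> collinear {A, B, C} \<and> \<not> collinear {A, B, D} \<and>
     \<not> collinear {A, C, D} \<and> \<not> collinear {B, C, D}"

text \<open>Vertices in cyclic order; degenerate parallelograms are allowed.\<close>

definition parallelogram :: "real^2 \<Rightarrow> real^2 \<Rightarrow> real^2 \<Rightarrow> real^2 \<Rightarrow> bool" where
  "parallelogram X Y W Z \<longleftrightarrow> W - X = (Y - X) + (Z - X)"

text \<open>Two lines that meet in a single point are neither parallel nor equal.\<close>

definition meet_at :: "(real^2) set \<Rightarrow> (real^2) set \<Rightarrow> real^2 \<Rightarrow> bool" where
  "meet_at l m P \<longleftrightarrow> l \<inter> m = {P}"

end

theory Submission
  imports Defs
begin

text \<open>
  Take \<open>P\<close> as origin and the two diagonals, with unit directions \<open>u\<close> and \<open>v\<close>, as oblique axes, so that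
  \<open>A = a u\<close>, \<open>C = c u\<close>, \<open>B = b v\<close>, \<open>D = d v\<close> with \<open>a, b, c, d\<close> nonzero. The sides \<open>AD\<close> and \<open>BC\<close>
  then have the equations \<open>x/a + y/d = 1\<close> and \<open>x/c + y/b = 1\<close>. A line through \<open>P\<close> cuts a segment
  with midpoint \<open>P\<close> out of them exactly when its direction \<open>(x, y)\<close> is a zero of the sum of the two
  linear forms, \<open>x (1/a + 1/c) + y (1/b + 1/d) = 0\<close>. This is the direction of the line joining
  \<open>AB \<inter> CD\<close> and \<open>AD \<inter> BC\<close> (the polar of \<open>P\<close> with respect to the pair of lines \<open>AD\<close>, \<open>BC\<close>),
  so what has to be shown is that \<open>PW\<close> is perpendicular to that direction.

  A perpendicular bisector is given by an equation in inner products, so the angle between the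
  diagonals never enters if a point \<open>T\<close> is recorded by the pair \<open>(T \<bullet> u, T \<bullet> v)\<close>. Solving the three linear
  systems for \<open>X\<close>, \<open>Y\<close>, \<open>Z\<close> in these dual coordinates gives, for \<open>W = Y + Z - X\<close>,
  \<open>2 (bc - ad) (cd - ab) (W \<bullet> u) = (a + c) b d ((a - c)\<^sup>2 - (b - d)\<^sup>2)\<close>
  and the same formula for \<open>W \<bullet> v\<close> with the diagonals exchanged
  (\<open>parallelogram_vertex_coordinate\<close>). Hence \<open>(W \<bullet> u, W \<bullet> v)\<close> is a multiple of
  \<open>(1/a + 1/c, 1/b + 1/d)\<close>, which is the required perpendicularity. The determinants
  \<open>bc - ad\<close> and \<open>cd - ab\<close> vanish when opposite sides are parallel, which the existence of the single
  points \<open>Y\<close> and \<open>Z\<close> excludes (\<open>meet_at_perpendiculars_not_parallel\<close>).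

  The reflection of \<open>Q\<close> in \<open>P\<close> therefore lies on \<open>BC\<close> and on the perpendicular at \<open>P\<close>
  (\<open>reflected_point_on_opposite_side\<close>), and \<open>R\<close> is the only such point.
\<close>

definition rot :: "real^2 \<Rightarrow> real^2" where
  "rot w = vector [- w$2, w$1]"

lemma inner_rot [simp]: "rot w \<bullet> w = 0"
  by (simp add: rot_def inner_vec_def sum_2)

lemma rot_eq_0_iff [simp]: "rot w = 0 \<longleftrightarrow> w = 0"
  by (auto simp: rot_def vec_eq_iff forall_2)

lemma orthogonal_imp_multiple_of_rot:
  fixes x w :: "real^2"
  assumes "x \<bullet> w = 0" "w \<noteq> 0"
  obtains k where "x = k *\<^sub>R rot w"
proof
  have n: "(w$1)^2 + (w$2)^2 \<noteq> 0"
    using assms(2) by (auto simp: vec_eq_iff forall_2 sum_power2_eq_zero_iff)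
  have o: "x$1 * w$1 + x$2 * w$2 = 0"
    using assms(1) by (simp add: inner_vec_def sum_2)
  define k where "k = (x$2 * w$1 - x$1 * w$2) / ((w$1)^2 + (w$2)^2)"
  have k: "k * ((w$1)^2 + (w$2)^2) = x$2 * w$1 - x$1 * w$2"
    using n by (simp add: k_def)
  have "((w$1)^2 + (w$2)^2) * (x$1 + k * w$2) = 0" 
    using k o by algebra
  moreover have "((w$1)^2 + (w$2)^2) * (x$2 - k * w$1) = 0" 
    using k o by algebra
  ultimately show "x = ((x$2 * w$1 - x$1 * w$2) / ((w$1)^2 + (w$2)^2)) *\<^sub>R rot w"
    using n by (auto simp: k_def [symmetric] rot_def vec_eq_iff forall_2)
qed

text \<open>In the plane, the vectors orthogonal to a nonzero \<open>w\<close> form a single line.\<close>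

lemma orthogonal_to_both_imp_parallel:
  fixes u v w :: "real^2"
  assumes "w \<bullet> u = 0" "w \<bullet> v = 0" "w \<noteq> 0" "u \<noteq> 0"
  obtains k where "v = k *\<^sub>R u"
proof -
  obtain i where i: "u = i *\<^sub>R rot w"
    using orthogonal_imp_multiple_of_rot assms by (metis inner_commute)
  obtain j where j: "v = j *\<^sub>R rot w"
    using orthogonal_imp_multiple_of_rot assms by (metis inner_commute)
  have "v = (j / i) *\<^sub>R u"
    using i j assms(4) by auto
  then show thesis ..
qed

text \<open>If the directions were parallel, translating the common point along the perpendicular
  direction would give a second common point.\<close>

lemma meet_at_perpendiculars_not_parallel:
  assumes "meet_at (perpendicular_at p U V) (perpendicular_at q S T) Y" "U \<noteq> V"
  shows "T - S \<noteq> k *\<^sub>R (V - U)"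
proof
  assume k: "T - S = k *\<^sub>R (V - U)"
  have Y: "Y \<in> perpendicular_at p U V \<inter> perpendicular_at q S T"
    using assms(1) by (simp add: meet_at_def)
  have eq: "Y + rot (V - U) - z = (Y - z) + rot (V - U)" for z
    by simp
  have "Y + rot (V - U) \<in> perpendicular_at p U V \<inter> perpendicular_at q S T"
    using Y k unfolding perpendicular_at_def orthogonal_def
    by (simp only: eq inner_add_left Int_iff mem_Collect_eq) simp
  then have "Y + rot (V - U) = Y"
    using assms(1) unfolding meet_at_def by blast
  then show False using assms(2) by simp
qed

text \<open>Equidistance is written with an arbitrary origin \<open>P\<close>; with \<open>A\<close> and \<open>B\<close> on fixed axes through
  \<open>P\<close> it becomes a linear equation in the dual coordinates of \<open>T\<close>.\<close>

lemma perp_bisector_iff: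
  "T \<in> perp_bisector A B \<longleftrightarrow>
     2 * ((T - P) \<bullet> (B - P)) - 2 * ((T - P) \<bullet> (A - P)) = (B - P) \<bullet> (B - P) - (A - P) \<bullet> (A - P)"
  by (auto simp: perp_bisector_def perpendicular_at_def orthogonal_def midpoint_def
      inner_diff_left inner_diff_right inner_add_left inner_add_right inner_commute algebra_simps)

lemma mem_line_through_iff:
  "T \<in> line_through A B \<longleftrightarrow> (\<exists>t. T = A + t *\<^sub>R (B - A))"
  unfolding line_through_def affine_hull_2_alt by auto

lemma unit_parametrization:
  fixes A C P :: "'a::real_inner"
  assumes "P = A + t *\<^sub>R (C - A)" "A \<noteq> C"
  obtains u a c where "u \<bullet> u = 1" "A = P + a *\<^sub>R u" "C = P + c *\<^sub>R u"
proof
  let ?n = "norm (C - A)"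
  have n: "?n \<noteq> 0" using assms(2) by simp
  show "((1 / ?n) *\<^sub>R (C - A)) \<bullet> ((1 / ?n) *\<^sub>R (C - A)) = 1"
    using n by (simp add: power2_norm_eq_inner [symmetric] power2_eq_square)
  show "A = P + (- t * ?n) *\<^sub>R ((1 / ?n) *\<^sub>R (C - A))"
    using n assms(1) by (simp add: algebra_simps)
  show "C = P + ((1 - t) * ?n) *\<^sub>R ((1 / ?n) *\<^sub>R (C - A))"
    using n assms(1) by (simp add: algebra_simps)
qed

lemma collinear_on_axis: "collinear {P + a *\<^sub>R u, P + b *\<^sub>R u, P + c *\<^sub>R u}"
proof -
  have "\<exists>k. P + s *\<^sub>R u - (P + t *\<^sub>R u) = k *\<^sub>R u" for s t
    by (rule exI [of _ "s - t"]) (simp add: algebra_simps)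
  then show ?thesis unfolding collinear_def by blast
qed

text \<open>Here \<open>x\<close>, \<open>(y, y')\<close> and \<open>(z, z')\<close> are the dual coordinates of \<open>X\<close>, \<open>Y\<close>, \<open>Z\<close>, and the hypotheses are the
  perpendicular bisector equations. Those of the sides keep their form when the diagonals are
  exchanged, so the lemma serves for both coordinates of \<open>W\<close>. The calculation rests on the fact that
  \<open>y - x\<close> and \<open>z - x\<close> have the same numerator \<open>(b - d) (bd - ac)\<close> up to sign.\<close>

lemma parallelogram_vertex_coordinate:
  fixes a b c d x y y' z z' :: real
  assumes "2 * x = a + c"
    and "2 * (a * y - b * y') = a\<^sup>2 - b\<^sup>2" "2 * (c * y - d * y') = c\<^sup>2 - d\<^sup>2"
    and "2 * (a * z - d * z') = a\<^sup>2 - d\<^sup>2" "2 * (c * z - b * z') = c\<^sup>2 - b\<^sup>2"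
  shows "2 * (b * c - a * d) * (c * d - a * b) * (y + z - x)
       = (a + c) * (b * d) * ((a - c)\<^sup>2 - (b - d)\<^sup>2)"
proof -
  have y: "2 * (b * c - a * d) * (y - x) = (b - d) * (b * d - a * c)"
    using assms(1-3) by algebra
  have z: "2 * (c * d - a * b) * (z - x) = (d - b) * (b * d - a * c)"
    using assms(1,4,5) by algebra
  show ?thesis using y z assms(1) by algebra
qed

text \<open>The point \<open>(x, y)\<close> is \<open>Q\<close> in the oblique axes, \<open>(p, q)\<close> are the dual coordinates of \<open>W\<close>, and
  the conclusion is the equation of \<open>BC\<close> at \<open>(-x, -y)\<close>. For nonzero \<open>b\<close> and \<open>c\<close> the hypothesis \<open>E\<close> says that
  \<open>(p, q)\<close> is proportional to \<open>(1/a + 1/c, 1/b + 1/d)\<close>, so that \<open>x/a + y/d\<close> and \<open>x/c + y/b\<close>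
  take opposite values on the line \<open>o\<close> through the origin. Multiplying by \<open>p\<close> and by \<open>q\<close>
  in turn avoids choosing a parameter on that line.\<close>

lemma reflected_point_on_opposite_side:
  fixes a b c d p q x y :: real
  assumes nz: "a \<noteq> 0" "d \<noteq> 0" and pq: "p \<noteq> 0 \<or> q \<noteq> 0"
    and E: "(a + c) * (b * d) * q = (b + d) * (a * c) * p"
    and o: "x * p + y * q = 0" and l: "d * x + a * y = a * d"
  shows "b * x + c * y = - (b * c)"
proof -
  have "p * (a * d) * (b * x + c * y + b * c) = 0" using E o l by algebra
  moreover have "q * (a * d) * (b * x + c * y + b * c) = 0" using E o l by algebra
  ultimately have "b * x + c * y + b * c = 0" using nz pq by auto
  then show ?thesis by simp
qed

theorem theorem4:
  fixes A B C D P X Y Z W Q R :: "real^2"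
  assumes "quadrilateral A B C D"
    and "meet_at (line_through A C) (line_through B D) P"
    and "meet_at (perp_bisector A C) (perp_bisector B D) X"
    and "meet_at (perp_bisector A B) (perp_bisector C D) Y"
    and "meet_at (perp_bisector A D) (perp_bisector B C) Z"
    and "parallelogram X Y W Z"
    and "W \<noteq> P"
    and "meet_at (perpendicular_at P P W) (line_through A D) Q"
    and "meet_at (perpendicular_at P P W) (line_through B C) R"
  shows "P = midpoint Q R"
proof -
  have nc: "\<not> collinear {A, B, C}" "\<not> collinear {A, B, D}"
      "\<not> collinear {A, C, D}" "\<not> collinear {B, C, D}"
    using assms(1) by (auto simp: quadrilateral_def)
  have ne: "A \<noteq> C" "B \<noteq> D" "A \<noteq> B" "A \<noteq> D"
    using nc by (auto simp: collinear_2 insert_commute)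
  have PAC: "P \<in> line_through A C" and PBD: "P \<in> line_through B D"
    using assms(2) by (auto simp: meet_at_def)
  obtain u a c where u: "u \<bullet> u = 1" and A: "A = P + a *\<^sub>R u" and C: "C = P + c *\<^sub>R u"
    using PAC ne(1) unit_parametrization mem_line_through_iff by metis
  obtain v b d where v: "v \<bullet> v = 1" and B: "B = P + b *\<^sub>R v" and D: "D = P + d *\<^sub>R v"
    using PBD ne(2) unit_parametrization mem_line_through_iff by metis

  have a: "a \<noteq> 0"
  proof
    assume "a = 0"
    then show False using nc(2) collinear_on_axis [of P 0 v b d] by (simp add: A B D)
  qed
  have d: "d \<noteq> 0"
  proof
    assume "d = 0"
    then show False using nc(3) collinear_on_axis [of P a u c 0] by (simp add: A C D)
  qed
  have c: "c \<noteq> 0"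
  proof
    assume "c = 0"
    then show False using nc(4) collinear_on_axis [of P b v 0 d] by (simp add: B C D)
  qed
  have uv: "v \<noteq> k *\<^sub>R u" for k
  proof
    assume "v = k *\<^sub>R u"
    then show False using nc(1) collinear_on_axis [of P a u "b * k" c] by (simp add: A B C)
  qed

  have "D - C \<noteq> (c / a) *\<^sub>R (B - A)"
    using meet_at_perpendiculars_not_parallel assms(4) ne(3) unfolding perp_bisector_def by blast
  moreover have "a *\<^sub>R (D - C) = c *\<^sub>R (B - A)" if "b * c - a * d = 0"
    using that by (simp add: A B C D algebra_simps)
  ultimately have det1: "b * c - a * d \<noteq> 0"
    using a by (metis divideR_right scaleR_scaleR divide_inverse_commute inverse_eq_divide)
  have "C - B \<noteq> (- c / a) *\<^sub>R (D - A)"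
    using meet_at_perpendiculars_not_parallel assms(5) ne(4) unfolding perp_bisector_def by blast
  moreover have "a *\<^sub>R (C - B) = (- c) *\<^sub>R (D - A)" if "c * d - a * b = 0"
    using that by (simp add: A B C D algebra_simps)
  ultimately have det2: "c * d - a * b \<noteq> 0"
    using a by (metis divideR_right scaleR_scaleR divide_inverse_commute inverse_eq_divide)

  \<comment> \<open>The dual coordinates of a point.\<close>
  define U V where "U T = (T - P) \<bullet> u" and "V T = (T - P) \<bullet> v" for T
  note bis = perp_bisector_iff [of _ _ _ P]
  have X: "2 * (U X * c) - 2 * (U X * a) = c\<^sup>2 - a\<^sup>2"
      "2 * (V X * d) - 2 * (V X * b) = d\<^sup>2 - b\<^sup>2"
    using assms(3) u v unfolding meet_at_def
    by (auto simp: bis A B C D U_def V_def power2_eq_square mult.commute dest!: equalityD2)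
  have Xu: "2 * U X = a + c"
  proof -
    have "(c - a) * (2 * U X - (a + c)) = 0" using X(1) by algebra
    moreover have "c \<noteq> a" using ne(1) A C by auto
    ultimately show ?thesis by simp
  qed
  have Xv: "2 * V X = b + d"
  proof -
    have "(d - b) * (2 * V X - (b + d)) = 0" using X(2) by algebra
    moreover have "d \<noteq> b" using ne(2) B D by auto
    ultimately show ?thesis by simp
  qed
  have Yuv: "2 * (a * U Y - b * V Y) = a\<^sup>2 - b\<^sup>2" "2 * (c * U Y - d * V Y) = c\<^sup>2 - d\<^sup>2"
    using assms(4) u v unfolding meet_at_def
    by (auto simp: bis A B C D U_def V_def power2_eq_square algebra_simps dest!: equalityD2)
  have Zuv: "2 * (a * U Z - d * V Z) = a\<^sup>2 - d\<^sup>2" "2 * (c * U Z - b * V Z) = c\<^sup>2 - b\<^sup>2"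
    using assms(5) u v unfolding meet_at_def
    by (auto simp: bis A B C D U_def V_def power2_eq_square algebra_simps dest!: equalityD2)
  have W: "W = Y + Z - X"
    using assms(6) by (simp add: parallelogram_def algebra_simps)
  have WUV: "U W = U Y + U Z - U X" "V W = V Y + V Z - V X"
    unfolding U_def V_def W by (simp_all add: inner_diff_left inner_add_left)

  have WU: "2 * (b * c - a * d) * (c * d - a * b) * U W
      = (a + c) * (b * d) * ((a - c)\<^sup>2 - (b - d)\<^sup>2)"
    unfolding WUV using parallelogram_vertex_coordinate Xu Yuv Zuv by blast
  have WV: "2 * (a * d - b * c) * (c * d - a * b) * V W
      = (b + d) * (a * c) * ((b - d)\<^sup>2 - (a - c)\<^sup>2)"
  proof -
    have "2 * (b * V Y - a * U Y) = b\<^sup>2 - a\<^sup>2" "2 * (d * V Y - c * U Y) = d\<^sup>2 - c\<^sup>2"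
      "2 * (b * V Z - c * U Z) = b\<^sup>2 - c\<^sup>2" "2 * (d * V Z - a * U Z) = d\<^sup>2 - a\<^sup>2"
      using Yuv Zuv by argo+
    from parallelogram_vertex_coordinate [OF Xv this]
    show ?thesis unfolding WUV by (simp only: mult.commute)
  qed
  \<comment> \<open>Multiplied by the determinants, both terms become
    \<open>(a + c) (b + d) a b c d ((a - c)\<^sup>2 - (b - d)\<^sup>2)\<close>.\<close>
  have "(2 * (b * c - a * d) * (c * d - a * b)) * ((a + c) * (b * d) * V W - (b + d) * (a * c) * U W) = 0"
    using WU WV by algebra
  then have E: "(a + c) * (b * d) * V W = (b + d) * (a * c) * U W"
    using det1 det2 by simp
  have nz: "U W \<noteq> 0 \<or> V W \<noteq> 0"
  proof (rule ccontr)
    assume "\<not> ?thesis"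
    moreover have "u \<noteq> 0" using u by auto
    ultimately obtain k where "v = k *\<^sub>R u"
      using orthogonal_to_both_imp_parallel [of "W - P" u v] assms(7)
      by (auto simp: U_def V_def)
    then show False using uv by blast
  qed

  have Q: "Q \<in> perpendicular_at P P W" "Q \<in> line_through A D"
    using assms(8) by (auto simp: meet_at_def)
  then obtain t where "Q = A + t *\<^sub>R (D - A)"
    by (auto simp: mem_line_through_iff)
  then have Qt: "Q = P + ((1 - t) * a) *\<^sub>R u + (t * d) *\<^sub>R v"
    by (simp add: A D algebra_simps)
  have "(1 - t) * a * U W + t * d * V W = 0"
    using Q(1) unfolding perpendicular_at_def orthogonal_def
    by (simp add: Qt U_def V_def inner_add_left inner_add_right inner_commute)
  then have l: "b * ((1 - t) * a) + c * (t * d) = - (b * c)"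
    by (rule reflected_point_on_opposite_side [OF a d nz E]) (simp add: algebra_simps)
  \<comment> \<open>The reflection of \<open>Q\<close> in \<open>P\<close> satisfies both conditions that determine \<open>R\<close>.\<close>
  have "2 *\<^sub>R P - Q \<in> line_through B C"
  proof -
    define s where "s = - ((1 - t) * a) / c"
    have s: "s * c = - ((1 - t) * a)" using c by (simp add: s_def)
    have "c * ((1 - s) * b + t * d) = 0" using l s by algebra
    then have "(1 - s) * b = - (t * d)" using c by simp
    moreover have "B + s *\<^sub>R (C - B) = P + ((1 - s) * b) *\<^sub>R v + (s * c) *\<^sub>R u"
      by (simp add: B C algebra_simps)
    ultimately have "2 *\<^sub>R P - Q = B + s *\<^sub>R (C - B)"
      using s by (simp add: Qt scaleR_2)
    then show ?thesis by (auto simp: mem_line_through_iff)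
  qed
  moreover have "2 *\<^sub>R P - Q \<in> perpendicular_at P P W"
  proof -
    have "2 *\<^sub>R P - Q - P = - (Q - P)" by (simp add: scaleR_2)
    then show ?thesis using Q(1) unfolding perpendicular_at_def orthogonal_def
      by (simp only: mem_Collect_eq inner_minus_left neg_equal_0_iff_equal)
  qed
  ultimately have "R = 2 *\<^sub>R P - Q"
    using assms(9) by (auto simp: meet_at_def)
  then show ?thesis by (simp add: midpoint_def)
qed

end
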